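(* In the weighted graph setting described in the context, if $\lambda$ is an eigenvalue of the Neumann-Poincaré operator $D'$ and $\lambda\neq\pm\frac12$, then $\lambda\in(-\frac12,\frac12)$.
   Context: Graph. $\mathcal G=(\mathcal V,\mathcal E)$ is a finite connected undirected graph without self-edges. $\mathcal V$ is partitioned into four nonempty disjoint sets $B,\Omega^+,\partial\Omega,\Omega^-$ such that, among pairs of distinct sets of the partition, the only ones joined by at least one edge are $\{B,\Omega^+\}$, $\{\Omega^+,\partial\Omega\}$, $\{\partial\Omega,\Omega^-\}$ (so there are no edges between $B$ and $\partial\Omega$, $B$ and $\Omega^-$, or $\Omega^+$ and $\Omega^-$). Put $\mathcal V^\circ=\mathcal V\setminus B$. Laplacian. The discrete gradient $\nabla$ is the $|\mathcal E|\times|\mathcal V|$ matrix with $(\nabla u)_k=u_i-u_j$, where $i,j$ are the endpoints of edge $k$ in a fixed order. For $s\in[0,\infty)^{|\mathcal E|}$, $L(s)=\nabla^T\mathrm{diag}(s)\nabla$. A conductivity $\sigma\in(0,\infty)^{|\mathcal E|}$ is fixed. $L[X,Y]$ denotes the submatrix with rows $X$, columns $Y$; $R_X$ is the $|X|\times|\mathcal V|$ matrix with $R_Xu=u|_X$. Green function. $G=R_{\mathcal V^\circ}^T\,L(\sigma)[\mathcal V^\circ,\mathcal V^\circ]^{-1}R_{\mathcal V^\circ}$ (the inverse exists since $\mathcal G$ is connected). Edge partition of unity. Let $\mathcal E^+$ be the edges with at least one node in $B\cup\Omega^+$ and $\mathcal E^-$ the edges with at least one node in $\Omega^-$. Fix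 any $p^+,p^-\in[0,1]^{|\mathcal E|}$ with $p^++p^-=1$, $p^+|_{\mathcal E^+}=1$, $p^-|_{\mathcal E^-}=1$. Set $\sigma^\pm=p^\pm\sigma$ (componentwise), so $L(\sigma)=L(\sigma^+)+L(\sigma^-)$. Operators. $\gamma_0=R_{\partial\Omega}$, $\gamma_1^\pm=\mp R_{\partial\Omega}L(\sigma^\pm)$, $\mathcal S=G\gamma_0^T$. The Neumann-Poincaré (adjoint double layer) operator is the $|\partial\Omega|\times|\partial\Omega|$ matrix $D'=\frac12(\gamma_1^++\gamma_1^-)\mathcal S$. *)

theory Defs
  imports
    "Graph_Theory.Digraph_Component"
    "Jordan_Normal_Form.Char_Poly"
    "Jordan_Normal_Form.Gauss_Jordan_Elimination"
    "Jordan_Normal_Form.DL_Submatrix"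
    "HOL-Library.Disjoint_Sets"
begin

text \<open>
  An undirected graph without self-edges is a \<^locale>\<open>pair_graph\<close>, that is, an irreflexive
  symmetric finite relation \<^const>\<open>parcs\<close> on \<^const>\<open>pverts\<close>; an edge is a pair of opposite
  arcs. Matrices over vertices and edges use an arbitrary fixed numbering: vertex number
  \<open>i\<close> is \<open>vs ! i\<close>, edge number \<open>k\<close> has the endpoints \<open>es ! k\<close> in this fixed order.
  All matrices and vectors are those of \<^theory>\<open>Jordan_Normal_Form.Matrix\<close>.
\<close>

definition vertex_numbering :: "'v pair_pre_digraph \<Rightarrow> 'v list \<Rightarrow> bool" where
  "vertex_numbering \<G> vs \<longleftrightarrow> distinct vs \<and> set vs = pverts \<G>"

text \<open>Each edge is listed exactly once, in exactly one of its two orientations.\<close>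

definition edge_numbering :: "'v pair_pre_digraph \<Rightarrow> ('v \<times> 'v) list \<Rightarrow> bool" where
  "edge_numbering \<G> es \<longleftrightarrow>
     distinct es \<and> set es \<subseteq> parcs \<G> \<and>
     (\<forall>(u, v) \<in> parcs \<G>. ((u, v) \<in> set es) \<noteq> ((v, u) \<in> set es))"

definition joined :: "'v pair_pre_digraph \<Rightarrow> 'v set \<Rightarrow> 'v set \<Rightarrow> bool" where
  "joined \<G> X Y \<longleftrightarrow> (\<exists>x \<in> X. \<exists>y \<in> Y. (x, y) \<in> parcs \<G>)"

text \<open>
  \<open>\<Omega>p\<close> and \<open>\<Omega>m\<close> are the sets \<open>\<Omega>\<^sup>+\<close> and \<open>\<Omega>\<^sup>-\<close>, and \<open>\<Gamma>\<close> is their interface, the boundary of \<open>\<Omega>\<close>.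
  The sets in \<^const>\<open>partition_on\<close> are nonempty and disjoint, and cover all vertices.
\<close>

definition layered_partition ::
  "'v pair_pre_digraph \<Rightarrow> 'v set \<Rightarrow> 'v set \<Rightarrow> 'v set \<Rightarrow> 'v set \<Rightarrow> bool" where
  "layered_partition \<G> B \<Omega>p \<Gamma> \<Omega>m \<longleftrightarrow>
     distinct [B, \<Omega>p, \<Gamma>, \<Omega>m] \<and>
     partition_on (pverts \<G>) {B, \<Omega>p, \<Gamma>, \<Omega>m} \<and>
     {{X, Y} | X Y. X \<in> {B, \<Omega>p, \<Gamma>, \<Omega>m} \<and> Y \<in> {B, \<Omega>p, \<Gamma>, \<Omega>m} \<and> X \<noteq> Y \<and> joined \<G> X Y}
       = {{B, \<Omega>p}, {\<Omega>p, \<Gamma>}, {\<Gamma>, \<Omega>m}}"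

definition grad :: "'v list \<Rightarrow> ('v \<times> 'v) list \<Rightarrow> real mat" where
  "grad vs es = mat (length es) (length vs)
     (\<lambda>(k, j). (if vs ! j = fst (es ! k) then 1 else 0) - (if vs ! j = snd (es ! k) then 1 else 0))"

definition laplacian :: "'v list \<Rightarrow> ('v \<times> 'v) list \<Rightarrow> real vec \<Rightarrow> real mat" where
  "laplacian vs es s =
     transpose_mat (grad vs es) * mat_diag (length es) (\<lambda>k. s $ k) * grad vs es"

definition indices :: "'v list \<Rightarrow> 'v set \<Rightarrow> nat set" where
  "indices vs X = {i. i < length vs \<and> vs ! i \<in> X}"

text \<open>The matrix \<open>R\<^sub>X\<close> of \<open>u \<mapsto> u|\<^sub>X\<close> consists of the rows of the identity indexed by \<open>X\<close>.\<close>

definition restr :: "'v list \<Rightarrow> 'v set \<Rightarrow> real mat" where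
  "restr vs X = submatrix (1\<^sub>m (length vs)) (indices vs X) UNIV"

text \<open>
  \<^const>\<open>mat_inverse\<close> returns \<^const>\<open>None\<close> on singular matrices; the block inverted here is
  nonsingular whenever the graph is connected, \<open>B\<close> is nonempty and \<open>\<sigma>\<close> is positive.
\<close>

definition green ::
  "'v list \<Rightarrow> ('v \<times> 'v) list \<Rightarrow> 'v set \<Rightarrow> real vec \<Rightarrow> real mat" where
  "green vs es B \<sigma> = (let Vo = set vs - B; I = indices vs Vo in
     transpose_mat (restr vs Vo) * the (mat_inverse (submatrix (laplacian vs es \<sigma>) I I))
       * restr vs Vo)"

definition edges_meeting :: "('v \<times> 'v) list \<Rightarrow> 'v set \<Rightarrow> nat set" where
  "edges_meeting es X = {k. k < length es \<and> (fst (es ! k) \<in> X \<or> snd (es ! k) \<in> X)}"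

definition edge_partition_of_unity ::
  "('v \<times> 'v) list \<Rightarrow> 'v set \<Rightarrow> 'v set \<Rightarrow> 'v set \<Rightarrow> real vec \<Rightarrow> real vec \<Rightarrow> bool" where
  "edge_partition_of_unity es B \<Omega>p \<Omega>m pp pm \<longleftrightarrow>
     pp \<in> carrier_vec (length es) \<and> pm \<in> carrier_vec (length es) \<and>
     (\<forall>k < length es. pp $ k \<in> {0..1} \<and> pm $ k \<in> {0..1} \<and> pp $ k + pm $ k = 1) \<and>
     (\<forall>k \<in> edges_meeting es (B \<union> \<Omega>p). pp $ k = 1) \<and>
     (\<forall>k \<in> edges_meeting es \<Omega>m. pm $ k = 1)"

definition cwise_mult :: "real vec \<Rightarrow> real vec \<Rightarrow> real vec" where
  "cwise_mult p s = vec (dim_vec s) (\<lambda>k. p $ k * s $ k)"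

text \<open>The traces \<open>\<gamma>\<^sub>0\<close> and \<open>\<gamma>\<^sub>1\<^sup>+\<close>, \<open>\<gamma>\<^sub>1\<^sup>-\<close>; the last two have opposite signs in front of \<open>R\<^sub>\<Gamma>\<close>.\<close>

definition trace0 :: "'v list \<Rightarrow> 'v set \<Rightarrow> real mat" where
  "trace0 vs \<Gamma> = restr vs \<Gamma>"

definition trace1_plus ::
  "'v list \<Rightarrow> ('v \<times> 'v) list \<Rightarrow> 'v set \<Rightarrow> real vec \<Rightarrow> real vec \<Rightarrow> real mat" where
  "trace1_plus vs es \<Gamma> \<sigma> pp = - (restr vs \<Gamma> * laplacian vs es (cwise_mult pp \<sigma>))"

definition trace1_minus ::
  "'v list \<Rightarrow> ('v \<times> 'v) list \<Rightarrow> 'v set \<Rightarrow> real vec \<Rightarrow> real vec \<Rightarrow> real mat" where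
  "trace1_minus vs es \<Gamma> \<sigma> pm = restr vs \<Gamma> * laplacian vs es (cwise_mult pm \<sigma>)"

definition single_layer ::
  "'v list \<Rightarrow> ('v \<times> 'v) list \<Rightarrow> 'v set \<Rightarrow> 'v set \<Rightarrow> real vec \<Rightarrow> real mat" where
  "single_layer vs es B \<Gamma> \<sigma> = green vs es B \<sigma> * transpose_mat (trace0 vs \<Gamma>)"

definition neumann_poincare ::
  "'v list \<Rightarrow> ('v \<times> 'v) list \<Rightarrow> 'v set \<Rightarrow> 'v set \<Rightarrow> real vec \<Rightarrow> real vec \<Rightarrow> real vec \<Rightarrow> real mat"
where
  "neumann_poincare vs es B \<Gamma> \<sigma> pp pm =
     (1/2) \<cdot>\<^sub>m ((trace1_plus vs es \<Gamma> \<sigma> pp + trace1_minus vs es \<Gamma> \<sigma> pm)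
       * single_layer vs es B \<Gamma> \<sigma>)"

end

theory Submission
  imports Defs
begin

text \<open>
  Let \<open>D' \<phi> = \<mu> \<phi>\<close> with \<open>\<phi> \<noteq> 0\<close> and put \<open>u = S \<phi>\<close>. Then \<open>u\<close> vanishes on \<open>B\<close>, and \<open>L(\<sigma>) u\<close> equals
  \<open>\<phi>\<close> on \<open>\<Gamma>\<close> and \<open>0\<close> on \<open>\<Omega>\<^sup>+\<close> and \<open>\<Omega>\<^sup>-\<close>. Since \<open>L(\<sigma>) = L(\<sigma>\<^sup>+) + L(\<sigma>\<^sup>-)\<close>, the eigenvalue equation reads
  \<open>L(\<sigma>\<^sup>-) u = (\<mu> + 1/2) L(\<sigma>) u\<close> on \<open>\<Gamma>\<close>; off \<open>\<Gamma> \<union> B\<close> both sides vanish. Pairing with \<open>u\<close> gives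
  \<open>E\<^sup>- = (\<mu> + 1/2) E\<close> for the Dirichlet energies, where \<open>0 \<le> E\<^sup>- \<le> E\<close>. Finally \<open>E \<noteq> 0\<close>, as otherwise
  \<open>u\<close> would be constant, hence zero, and so would be \<open>\<phi>\<close>.
\<close>

section \<open>Complexified matrices and restriction to vertex sets\<close>

abbreviation cmat :: "real mat \<Rightarrow> complex mat" where
  "cmat \<equiv> map_mat complex_of_real"

text \<open>The operator D' need not be symmetric, so its eigenvectors must be taken complex a
  priori. Products of real matrices are unfolded factor by factor on such vectors.\<close>

lemma cmat_mult_mult_vec:
  assumes "A \<in> carrier_mat a b" "C \<in> carrier_mat b c" "v \<in> carrier_vec c"
  shows "cmat (A * C) *\<^sub>v v = cmat A *\<^sub>v (cmat C *\<^sub>v v)"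
  using assms by (subst of_real_hom.mat_hom_mult) auto

lemma finite_indices: "finite (indices vs X)"
  unfolding indices_def by auto

text \<open>The library facts on \<open>submatrix\<close> measure dimensions by sets of the form on
  the left.\<close>

lemma indices_below: "{i. i < length vs \<and> i \<in> indices vs X} = indices vs X"
  unfolding indices_def by auto

lemma pick_indices:
  assumes "i < card (indices vs X)"
  shows "pick (indices vs X) i < length vs" "vs ! pick (indices vs X) i \<in> X"
  using pick_in_set_le[OF assms] by (auto simp: indices_def)

text \<open>The position of \<open>j\<close> is the number of members of the index set below it.
  These members form a proper subset, since \<open>j\<close> is missing, so the position is in
  range.\<close>

lemma pick_indices_surj:
  assumes "j < length vs" "vs ! j \<in> X"
  obtains i where "i < card (indices vs X)" "pick (indices vs X) i = j"
proof -
  have j: "j \<in> indices vs X" using assms by (simp add: indices_def)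
  hence "{a \<in> indices vs X. a < j} \<subset> indices vs X" by blast
  hence "card {a \<in> indices vs X. a < j} < card (indices vs X)"
    by (rule psubset_card_mono[OF finite_indices])
  with pick_card_in_set[OF j] that show thesis by blast
qed

lemma restr_carrier [simp]: "restr vs X \<in> carrier_mat (card (indices vs X)) (length vs)"
  unfolding restr_def
  by (rule carrier_matI) (simp_all only: dim_submatrix index_one_mat indices_below UNIV_I simp_thms card_Collect_less_nat)

lemma dim_restr [simp]:
  "dim_row (restr vs X) = card (indices vs X)" "dim_col (restr vs X) = length vs"
  by (rule carrier_matD[OF restr_carrier])+

lemma restr_index:
  assumes "i < card (indices vs X)" "j < length vs"
  shows "restr vs X $$ (i, j) = (if pick (indices vs X) i = j then 1 else 0)"
proof -
  have "restr vs X $$ (i, j) = 1\<^sub>m (length vs) $$ (pick (indices vs X) i, pick UNIV j)"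
    unfolding restr_def by (rule submatrix_index) (use assms in \<open>simp_all add: indices_below\<close>)
  thus ?thesis using assms pick_indices(1)[OF assms(1)] by (simp add: pick_UNIV)
qed

lemma restr_mult_index:
  assumes "A \<in> carrier_mat (length vs) m" "i < card (indices vs X)" "j < m"
  shows "(restr vs X * A) $$ (i, j) = A $$ (pick (indices vs X) i, j)"
proof -
  have "(restr vs X * A) $$ (i, j) = (\<Sum>l<length vs. restr vs X $$ (i, l) * A $$ (l, j))"
    using assms by (simp add: scalar_prod_def atLeast0LessThan)
  also have "\<dots> = (\<Sum>l<length vs. if l = pick (indices vs X) i then A $$ (l, j) else 0)"
    by (rule sum.cong) (use assms in \<open>auto simp: restr_index\<close>)
  finally show ?thesis using pick_indices(1)[OF assms(2)] by simp
qed

text \<open>Transposition reduces this to the row selection of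
  \<open>restr_mult_index\<close>.\<close>

lemma mult_restr_transpose_index:
  assumes "A \<in> carrier_mat m (length vs)" "i < m" "j < card (indices vs X)"
  shows "(A * transpose_mat (restr vs X)) $$ (i, j) = A $$ (i, pick (indices vs X) j)"
proof -
  have "(A * transpose_mat (restr vs X)) $$ (i, j)
      = transpose_mat (A * transpose_mat (restr vs X)) $$ (j, i)"
    using assms by simp
  also have "transpose_mat (A * transpose_mat (restr vs X)) = restr vs X * transpose_mat A"
    using assms by (subst transpose_mult) auto
  also have "(restr vs X * transpose_mat A) $$ (j, i) = A $$ (i, pick (indices vs X) j)"
    using assms pick_indices(1)[OF assms(3)] by (subst restr_mult_index) auto
  finally show ?thesis .
qed

lemma cmat_restr_mult_vec_index:
  assumes "w \<in> carrier_vec (length vs)" "i < card (indices vs X)"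
  shows "(cmat (restr vs X) *\<^sub>v w) $ i = w $ pick (indices vs X) i"
proof -
  have "(cmat (restr vs X) *\<^sub>v w) $ i
      = (\<Sum>l<length vs. complex_of_real (restr vs X $$ (i, l)) * w $ l)"
    using assms
    by (auto simp: scalar_prod_def atLeast0LessThan intro!: sum.cong)
  also have "\<dots> = (\<Sum>l<length vs. if l = pick (indices vs X) i then w $ l else 0)"
    by (rule sum.cong) (use assms in \<open>auto simp: restr_index\<close>)
  finally show ?thesis using pick_indices(1)[OF assms(2)] by simp
qed

text \<open>The transpose of \<open>restr vs X\<close> is extension by zero: \<open>pick\<close>
  only reaches vertices of \<open>X\<close>, so its row at any other vertex vanishes.\<close>

lemma cmat_restr_transpose_mult_vec_eq_0:
  assumes "v \<in> carrier_vec (card (indices vs X))" "l < length vs" "vs ! l \<notin> X"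
  shows "(cmat (transpose_mat (restr vs X)) *\<^sub>v v) $ l = 0"
proof -
  have "(cmat (transpose_mat (restr vs X)) *\<^sub>v v) $ l
      = (\<Sum>i<card (indices vs X). complex_of_real (restr vs X $$ (i, l)) * v $ i)"
    using assms
    by (auto simp: scalar_prod_def atLeast0LessThan intro!: sum.cong)
  also have "\<dots> = 0"
    by (rule sum.neutral) (use assms pick_indices(2)[of _ vs X] in \<open>auto simp: restr_index\<close>)
  finally show ?thesis .
qed

text \<open>\<open>pick\<close> is injective on positions in range, so restriction undoes extension
  by zero.\<close>

lemma restr_mult_restr_transpose:
  "restr vs X * transpose_mat (restr vs X) = 1\<^sub>m (card (indices vs X))" (is "?R * _ = _")
proof (rule eq_matI)
  fix i j assume "i < dim_row (1\<^sub>m (card (indices vs X)) :: real mat)"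
    "j < dim_col (1\<^sub>m (card (indices vs X)) :: real mat)"
  hence ij: "i < card (indices vs X)" "j < card (indices vs X)" by auto
  have "pick (indices vs X) i = pick (indices vs X) j \<longleftrightarrow> i = j"
    by (metis card_pick_le ij)
  moreover have "(?R * transpose_mat ?R) $$ (i, j) = ?R $$ (i, pick (indices vs X) j)"
    by (rule mult_restr_transpose_index) (use ij in auto)
  ultimately show "(?R * transpose_mat ?R) $$ (i, j) = 1\<^sub>m (card (indices vs X)) $$ (i, j)"
    using ij pick_indices(1)[OF ij(2)] by (simp add: restr_index)
qed auto

text \<open>As a product, the block acts by extending by zero, applying \<open>A\<close> and
  restricting, and associativity becomes available for it.\<close>

lemma submatrix_indices:
  assumes "A \<in> carrier_mat (length vs) (length vs)"
  shows "submatrix A (indices vs X) (indices vs X) = restr vs X * (A * transpose_mat (restr vs X))"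
    (is "?S = _")
proof (rule eq_matI)
  let ?c = "card (indices vs X)"
  have AR: "A * transpose_mat (restr vs X) \<in> carrier_mat (length vs) ?c"
    using assms by (intro mult_carrier_mat[of _ _ "length vs"]) auto
  show dim: "dim_row ?S = dim_row (restr vs X * (A * transpose_mat (restr vs X)))"
    "dim_col ?S = dim_col (restr vs X * (A * transpose_mat (restr vs X)))"
    using assms by (auto simp: dim_submatrix indices_below)
  fix i j assume "i < dim_row (restr vs X * (A * transpose_mat (restr vs X)))"
    "j < dim_col (restr vs X * (A * transpose_mat (restr vs X)))"
  hence ij: "i < ?c" "j < ?c" by auto
  have "?S $$ (i, j) = A $$ (pick (indices vs X) i, pick (indices vs X) j)"
    by (rule submatrix_index) (use assms ij in \<open>auto simp: indices_below\<close>)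
  also have "\<dots> = (A * transpose_mat (restr vs X)) $$ (pick (indices vs X) i, j)"
    by (rule mult_restr_transpose_index[symmetric]) (use assms ij pick_indices(1)[OF ij(1)] in auto)
  also have "\<dots> = (restr vs X * (A * transpose_mat (restr vs X))) $$ (i, j)"
    by (rule restr_mult_index[symmetric, OF AR ij])
  finally show "?S $$ (i, j) = (restr vs X * (A * transpose_mat (restr vs X))) $$ (i, j)" .
qed

section \<open>Gradient, Laplacian and Dirichlet energy\<close>

lemma grad_carrier [simp]: "grad vs es \<in> carrier_mat (length es) (length vs)"
  unfolding grad_def by simp

lemma laplacian_carrier [simp]: "laplacian vs es s \<in> carrier_mat (length vs) (length vs)"
  unfolding laplacian_def by (intro mult_carrier_mat[of _ _ "length es"]) auto

lemma dim_grad [simp]: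
  "dim_row (grad vs es) = length es" "dim_col (grad vs es) = length vs"
  by (rule carrier_matD[OF grad_carrier])+

lemma dim_laplacian [simp]:
  "dim_row (laplacian vs es s) = length vs" "dim_col (laplacian vs es s) = length vs"
  by (rule carrier_matD[OF laplacian_carrier])+

text \<open>Divergence form of the Laplacian. The gradient of \<open>w\<close> stays intact and
  \<open>s\<close> enters linearly edge by edge, which serves the energy identity, locality and the
  splitting of \<sigma>.\<close>

lemma laplacian_mult_vec_index:
  fixes w :: "complex vec"
  assumes w: "w \<in> carrier_vec (length vs)" and i: "i < length vs"
  shows "(cmat (laplacian vs es s) *\<^sub>v w) $ i
    = (\<Sum>k<length es. complex_of_real (grad vs es $$ (k, i) * s $ k) * (cmat (grad vs es) *\<^sub>v w) $ k)"
proof -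
  let ?g = "grad vs es"
  have entry: "laplacian vs es s $$ (i, j)
      = (\<Sum>k<length es. ?g $$ (k, i) * s $ k * ?g $$ (k, j))" if j: "j < length vs" for j
  proof -
    have "laplacian vs es s $$ (i, j)
        = (\<Sum>k<length es. (transpose_mat ?g * mat_diag (length es) (\<lambda>k. s $ k)) $$ (i, k) * ?g $$ (k, j))"
      using i j
      by (simp add: laplacian_def scalar_prod_def atLeast0LessThan mat_diag_def)
    also have "\<dots> = (\<Sum>k<length es. ?g $$ (k, i) * s $ k * ?g $$ (k, j))"
      using i
      by (intro sum.cong refl) (subst mat_diag_mult_right[of _ "length vs"], auto)
    finally show ?thesis .
  qed
  have gw: "(cmat ?g *\<^sub>v w) $ k = (\<Sum>j<length vs. complex_of_real (?g $$ (k, j)) * w $ j)"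
    if "k < length es" for k
    using that w
    by (auto simp: scalar_prod_def atLeast0LessThan intro!: sum.cong)
  have "(cmat (laplacian vs es s) *\<^sub>v w) $ i
      = (\<Sum>j<length vs. complex_of_real (laplacian vs es s $$ (i, j)) * w $ j)"
    using i w
    by (auto simp: scalar_prod_def atLeast0LessThan intro!: sum.cong)
  also have "\<dots> = (\<Sum>j<length vs. \<Sum>k<length es.
      complex_of_real (?g $$ (k, i) * s $ k) * (complex_of_real (?g $$ (k, j)) * w $ j))"
    by (simp add: entry sum_distrib_right mult.assoc)
  also have "\<dots> = (\<Sum>k<length es. complex_of_real (?g $$ (k, i) * s $ k) * (cmat ?g *\<^sub>v w) $ k)"
    by (subst sum.swap) (simp add: gw sum_distrib_left del: index_mult_mat_vec)
  finally show ?thesis .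
qed

text \<open>Summation by parts: the gradient is real and commutes with conjugation, so each edge
  contributes its conductivity times a squared modulus. In particular the pairing is real.\<close>

lemma dirichlet_energy:
  fixes w :: "complex vec"
  assumes w: "w \<in> carrier_vec (length vs)"
  shows "(\<Sum>i<length vs. cnj (w $ i) * (cmat (laplacian vs es s) *\<^sub>v w) $ i)
    = complex_of_real (\<Sum>k<length es. s $ k * (cmod ((cmat (grad vs es) *\<^sub>v w) $ k))\<^sup>2)"
proof -
  let ?g = "grad vs es" and ?d = "cmat (grad vs es) *\<^sub>v w"
  have gw: "cnj (?d $ k) = (\<Sum>j<length vs. complex_of_real (?g $$ (k, j)) * cnj (w $ j))"
    if "k < length es" for k
    using that w
    by (auto simp: scalar_prod_def atLeast0LessThan intro!: sum.cong)
  have "(\<Sum>i<length vs. cnj (w $ i) * (cmat (laplacian vs es s) *\<^sub>v w) $ i)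
      = (\<Sum>i<length vs. \<Sum>k<length es.
          s $ k * ?d $ k * (complex_of_real (?g $$ (k, i)) * cnj (w $ i)))"
    using w by (simp add: laplacian_mult_vec_index sum_distrib_left mult_ac del: index_mult_mat_vec)
  also have "\<dots> = (\<Sum>k<length es. s $ k * (?d $ k * cnj (?d $ k)))"
    by (subst sum.swap) (simp add: gw sum_distrib_left mult_ac del: index_mult_mat_vec)
  also have "\<dots> = complex_of_real (\<Sum>k<length es. s $ k * (cmod (?d $ k))\<^sup>2)"
    by (simp only: of_real_sum of_real_mult complex_norm_square)
  finally show ?thesis .
qed

text \<open>Locality: the gradient column of a vertex vanishes on edges that do not meet it. Away
  from the interface this compares \<sigma> with its two parts.\<close>

lemma laplacian_mult_vec_cong:
  fixes w :: "complex vec"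
  assumes "w \<in> carrier_vec (length vs)" "i < length vs"
    and "\<And>k. k \<in> edges_meeting es {vs ! i} \<Longrightarrow> s $ k = t $ k"
  shows "(cmat (laplacian vs es s) *\<^sub>v w) $ i = (cmat (laplacian vs es t) *\<^sub>v w) $ i"
proof -
  have eq: "grad vs es $$ (k, i) * s $ k = grad vs es $$ (k, i) * t $ k" if "k < length es" for k
  proof (cases "k \<in> edges_meeting es {vs ! i}")
    case False
    hence "grad vs es $$ (k, i) = 0" using that assms(2) by (auto simp: grad_def edges_meeting_def)
    thus ?thesis by simp
  qed (use assms(3) in auto)
  show ?thesis
    unfolding laplacian_mult_vec_index[OF assms(1,2)]
    by (rule sum.cong) (simp_all only: eq lessThan_iff)
qed

section \<open>Connected networks: uniqueness for the Dirichlet problem\<close>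

locale conductivity_network =
  fixes \<G> :: "'v pair_pre_digraph" and vs :: "'v list" and es :: "('v \<times> 'v) list"
    and B :: "'v set" and \<sigma> :: "real vec"
  assumes connected: "connected (with_proj \<G>)"
    and vs: "vertex_numbering \<G> vs" and es: "edge_numbering \<G> es"
    and graph: "pair_graph \<G>"
    and B: "B \<subseteq> pverts \<G>" "B \<noteq> {}"
    and pos: "k < length es \<Longrightarrow> \<sigma> $ k > 0"
begin

lemma nth_vs_eq_iff: "i < length vs \<Longrightarrow> j < length vs \<Longrightarrow> vs ! i = vs ! j \<longleftrightarrow> i = j"
  using vs by (simp add: vertex_numbering_def nth_eq_iff_index_eq)

lemma grad_mult_vec_index:
  fixes w :: "complex vec"
  assumes w: "w \<in> carrier_vec (length vs)" and k: "k < length es"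
    and ij: "i < length vs" "j < length vs" "es ! k = (vs ! i, vs ! j)"
  shows "(cmat (grad vs es) *\<^sub>v w) $ k = w $ i - w $ j"
proof -
  have "(cmat (grad vs es) *\<^sub>v w) $ k = (\<Sum>l<length vs. complex_of_real (grad vs es $$ (k, l)) * w $ l)"
    using k w
    by (auto simp: scalar_prod_def atLeast0LessThan intro!: sum.cong)
  also have "\<dots> = (\<Sum>l<length vs. (if l = i then w $ l else 0) - (if l = j then w $ l else 0))"
    by (rule sum.cong) (use k ij nth_vs_eq_iff in \<open>auto simp: grad_def\<close>)
  finally show ?thesis using ij by (simp add: sum_subtractf)
qed

text \<open>A vanishing gradient means equal values across each edge; connectedness carries this
  along a path.\<close>

lemma eq_of_grad_eq_0:
  fixes w :: "complex vec"
  assumes w: "w \<in> carrier_vec (length vs)"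
    and grad0: "\<And>k. k < length es \<Longrightarrow> (cmat (grad vs es) *\<^sub>v w) $ k = 0"
    and i: "i < length vs" and j: "j < length vs"
  shows "w $ i = w $ j"
proof -
  interpret pair_graph \<G> by (rule graph)
  have arc: "w $ i = w $ j" if a: "(vs ! i, vs ! j) \<in> parcs \<G>" "i < length vs" "j < length vs" for i j
  proof -
    \<comment> \<open>Only one orientation of the edge is listed; the other one merely flips the
      sign of the difference.\<close>
    have "(vs ! i, vs ! j) \<in> set es \<or> (vs ! j, vs ! i) \<in> set es"
      using a es unfolding edge_numbering_def by blast
    thus ?thesis
      using grad_mult_vec_index[OF w] grad0 a by (metis eq_iff_diff_eq_0 in_set_conv_nth)
  qed
  have "strongly_connected (with_proj \<G>)"
    by (rule symmetric_connected_imp_strongly_connected[OF pair_sym_arcs connected])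
  moreover have "vs ! i \<in> pverts \<G>" "vs ! j \<in> pverts \<G>"
    using vs i j nth_mem unfolding vertex_numbering_def by blast+
  ultimately have "vs ! i \<rightarrow>\<^sup>*\<^bsub>with_proj \<G>\<^esub> vs ! j" unfolding strongly_connected_def by auto
  \<comment> \<open>The path induction runs over vertices while \<open>w\<close> is indexed by
    positions, so the claim covers every position of the vertex.\<close>
  hence "\<forall>j<length vs. vs ! j = x \<longrightarrow> w $ i = w $ j" if "x = vs ! j" for x
    unfolding that
  proof (induction rule: reachable_induct)
    case base
    show ?case using nth_vs_eq_iff i by auto
  next
    case (step x y)
    hence xy: "(x, y) \<in> parcs \<G>" by simp
    then obtain l where l: "l < length vs" "vs ! l = x"
      using in_arcsD1 vs unfolding vertex_numbering_def by (metis in_set_conv_nth)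
    show ?case using step.IH l xy arc by metis
  qed
  thus ?thesis using j by blast
qed

text \<open>Positive conductivities force each edge term, hence the gradient, to vanish. So
  \<open>w\<close> is constant, with the value zero that it has on the nonempty set
  \<open>B\<close>.\<close>

lemma eq_0_of_energy_eq_0:
  fixes w :: "complex vec"
  assumes w: "w \<in> carrier_vec (length vs)"
    and wB: "\<And>i. i < length vs \<Longrightarrow> vs ! i \<in> B \<Longrightarrow> w $ i = 0"
    and energy: "(\<Sum>k<length es. \<sigma> $ k * (cmod ((cmat (grad vs es) *\<^sub>v w) $ k))\<^sup>2) = 0"
  shows "w = 0\<^sub>v (length vs)"
proof -
  have zero: "\<forall>k\<in>{..<length es}. \<sigma> $ k * (cmod ((cmat (grad vs es) *\<^sub>v w) $ k))\<^sup>2 = 0"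
    using energy by (subst (asm) sum_nonneg_eq_0_iff) (auto simp: pos less_imp_le)
  have grad0: "(cmat (grad vs es) *\<^sub>v w) $ k = 0" if "k < length es" for k
    using bspec[OF zero, of k] pos[of k] that by (simp del: index_mult_mat_vec)
  obtain b where b: "b < length vs" "vs ! b \<in> B"
    using B vs unfolding vertex_numbering_def by (metis all_not_in_conv in_set_conv_nth subsetD)
  show ?thesis
    using w wB[OF b] eq_of_grad_eq_0[OF w grad0 _ b(1)] by (intro eq_vecI) auto
qed

text \<open>In the pairing of \<open>w\<close> with its Laplacian one factor vanishes at every
  vertex, so the energy is zero.\<close>

lemma eq_0_of_laplacian_eq_0:
  fixes w :: "complex vec"
  assumes w: "w \<in> carrier_vec (length vs)"
    and wB: "\<And>i. i < length vs \<Longrightarrow> vs ! i \<in> B \<Longrightarrow> w $ i = 0"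
    and harm: "\<And>i. i < length vs \<Longrightarrow> vs ! i \<notin> B \<Longrightarrow> (cmat (laplacian vs es \<sigma>) *\<^sub>v w) $ i = 0"
  shows "w = 0\<^sub>v (length vs)"
proof (rule eq_0_of_energy_eq_0[OF w wB])
  have "(\<Sum>i<length vs. cnj (w $ i) * (cmat (laplacian vs es \<sigma>) *\<^sub>v w) $ i) = 0"
    using wB harm by (intro sum.neutral) auto
  thus "(\<Sum>k<length es. \<sigma> $ k * (cmod ((cmat (grad vs es) *\<^sub>v w) $ k))\<^sup>2) = 0"
    unfolding dirichlet_energy[OF w] of_real_eq_0_iff .
qed

section \<open>Green function, single layer potential and the action of D'\<close>

abbreviation "Ro \<equiv> restr vs (set vs - B)"
abbreviation "Io \<equiv> indices vs (set vs - B)"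

text \<open>A kernel vector of the block, extended by zero to \<open>B\<close>, has zero Laplacian
  off \<open>B\<close>. Uniqueness kills the extension, and restricting it gives back the kernel
  vector.\<close>

lemma det_interior_block_nonzero:
  "det (submatrix (laplacian vs es \<sigma>) Io Io) \<noteq> 0" (is "det ?A \<noteq> 0")
proof
  let ?L = "laplacian vs es \<sigma>"
  have A: "?A = Ro * (?L * transpose_mat Ro)" by (rule submatrix_indices) simp
  have LR: "?L * transpose_mat Ro \<in> carrier_mat (length vs) (card Io)"
    by (rule mult_carrier_mat[of _ _ "length vs"]) auto
  have Ac: "?A \<in> carrier_mat (card Io) (card Io)"
    unfolding A by (rule mult_carrier_mat[OF restr_carrier LR])
  assume "det ?A = 0"
  then obtain v where v: "v \<in> carrier_vec (card Io)" "v \<noteq> 0\<^sub>v (card Io)" "?A *\<^sub>v v = 0\<^sub>v (card Io)"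
    using det_0_iff_vec_prod_zero_field[OF Ac] by auto
  \<comment> \<open>The kernel vector is real; it is embedded to match the complex uniqueness
    lemma.\<close>
  let ?v = "map_vec complex_of_real v"
  define w where "w = cmat (transpose_mat Ro) *\<^sub>v ?v"
  have vc: "?v \<in> carrier_vec (card Io)" using v by simp
  have w: "w \<in> carrier_vec (length vs)" unfolding w_def by (intro mult_mat_vec_carrier[OF _ vc]) simp
  have "cmat ?A *\<^sub>v ?v = cmat Ro *\<^sub>v (cmat ?L *\<^sub>v w)"
    unfolding A w_def
    by (subst cmat_mult_mult_vec[OF restr_carrier LR vc], subst cmat_mult_mult_vec[OF _ _ vc]) auto
  moreover have "cmat ?A *\<^sub>v ?v = 0\<^sub>v (card Io)"
    using of_real_hom.mult_mat_vec_hom[OF Ac v(1), where 'a = complex] unfolding v(3)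
    by (metis of_real_hom.vec_hom_zero)
  ultimately have Rv: "cmat Ro *\<^sub>v (cmat ?L *\<^sub>v w) = 0\<^sub>v (card Io)" by simp
  have Lw: "cmat ?L *\<^sub>v w \<in> carrier_vec (length vs)" by (intro mult_mat_vec_carrier[OF _ w]) simp
  have "w = 0\<^sub>v (length vs)"
  proof (rule eq_0_of_laplacian_eq_0[OF w])
    fix i assume i: "i < length vs"
    show "w $ i = 0" if "vs ! i \<in> B"
      unfolding w_def by (rule cmat_restr_transpose_mult_vec_eq_0[OF vc i]) (use that in auto)
    show "(cmat ?L *\<^sub>v w) $ i = 0" if "vs ! i \<notin> B"
    proof -
      from i that obtain k where "k < card Io" "pick Io k = i"
        by (metis DiffI nth_mem pick_indices_surj)
      thus ?thesis using Rv cmat_restr_mult_vec_index[OF Lw] by (metis index_zero_vec(1))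
    qed
  qed
  moreover have "cmat Ro *\<^sub>v w = ?v"
  proof -
    have "cmat Ro *\<^sub>v w = cmat (Ro * transpose_mat Ro) *\<^sub>v ?v"
      unfolding w_def
      by (rule cmat_mult_mult_vec[symmetric, OF _ _ vc]) auto
    thus ?thesis using vc by (simp add: restr_mult_restr_transpose of_real_hom.mat_hom_one)
  qed
  moreover have "cmat Ro *\<^sub>v 0\<^sub>v (length vs) = 0\<^sub>v (card Io)"
    by (intro eq_vecI) auto
  ultimately have "?v = 0\<^sub>v (card Io)" by metis
  hence "v = 0\<^sub>v (card Io)" by simp
  thus False using v(2) by simp
qed

text \<open>A nonzero determinant makes the block a unit, so \<open>mat_inverse\<close> cannot
  return \<open>None\<close> and \<open>the\<close> yields a genuine inverse.\<close>

lemma green_eq: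
  obtains C where "C \<in> carrier_mat (card Io) (card Io)"
    "green vs es B \<sigma> = transpose_mat Ro * C * Ro"
    "Ro * (laplacian vs es \<sigma> * transpose_mat Ro) * C = 1\<^sub>m (card Io)"
proof -
  let ?A = "submatrix (laplacian vs es \<sigma>) Io Io"
  have A: "?A = Ro * (laplacian vs es \<sigma> * transpose_mat Ro)" by (rule submatrix_indices) simp
  have Ac: "?A \<in> carrier_mat (card Io) (card Io)"
    unfolding A by (intro mult_carrier_mat[of _ _ "length vs"]) auto
  obtain C where "mat_inverse ?A = Some C"
    using mat_inverse(1)[OF Ac, where b = "()"]
      det_non_zero_imp_unit[OF Ac det_interior_block_nonzero, where b = "()"] by blast
  moreover from mat_inverse(2)[OF Ac this]
  have "C \<in> carrier_mat (card Io) (card Io)" "?A * C = 1\<^sub>m (card Io)" by auto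
  ultimately show thesis using that[of C] by (simp add: green_def Let_def A)
qed

text \<open>The inverse block cancels once the Laplacian is restricted to the interior. The
  factorisation through \<open>transpose_mat Ro\<close> records the zero values on
  \<open>B\<close>.\<close>

lemma single_layer_eq:
  obtains M where "M \<in> carrier_mat (card Io) (card (indices vs \<Gamma>))"
    "single_layer vs es B \<Gamma> \<sigma> = transpose_mat Ro * M"
    "Ro * (laplacian vs es \<sigma> * single_layer vs es B \<Gamma> \<sigma>) = Ro * transpose_mat (restr vs \<Gamma>)"
proof -
  let ?L = "laplacian vs es \<sigma>" and ?R = "transpose_mat (restr vs \<Gamma>)" and ?n = "length vs"
    and ?o = "card Io" and ?g = "card (indices vs \<Gamma>)"
  obtain C where C: "C \<in> carrier_mat ?o ?o" "green vs es B \<sigma> = transpose_mat Ro * C * Ro"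
    "Ro * (?L * transpose_mat Ro) * C = 1\<^sub>m ?o"
    by (rule green_eq)
  \<comment> \<open>\<open>M\<close> maps a density on \<Gamma> to the values of its potential off
    \<open>B\<close>: extend by zero, restrict to the interior, invert.\<close>
  define M where "M = C * (Ro * ?R)"
  have Ro: "Ro \<in> carrier_mat ?o ?n" and RoT: "transpose_mat Ro \<in> carrier_mat ?n ?o"
    and R: "?R \<in> carrier_mat ?n ?g" and L: "?L \<in> carrier_mat ?n ?n"
    by simp_all
  have RR: "Ro * ?R \<in> carrier_mat ?o ?g" by (rule mult_carrier_mat[OF Ro R])
  have M: "M \<in> carrier_mat ?o ?g" unfolding M_def by (rule mult_carrier_mat[OF C(1) RR])
  have S: "single_layer vs es B \<Gamma> \<sigma> = transpose_mat Ro * M"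
    unfolding single_layer_def trace0_def C(2) M_def
    by (simp only: assoc_mult_mat[OF mult_carrier_mat[OF RoT C(1)] Ro R] assoc_mult_mat[OF RoT C(1) RR])
  have LR: "?L * transpose_mat Ro \<in> carrier_mat ?n ?o" by (rule mult_carrier_mat[OF L RoT])
  have "Ro * (?L * (transpose_mat Ro * M)) = Ro * (?L * transpose_mat Ro) * M"
    by (simp only: assoc_mult_mat[OF L RoT M] assoc_mult_mat[OF Ro LR M])
  also have "\<dots> = Ro * (?L * transpose_mat Ro) * C * (Ro * ?R)"
    unfolding M_def by (rule assoc_mult_mat[symmetric, OF mult_carrier_mat[OF Ro LR] C(1) RR])
  also have "\<dots> = Ro * ?R"
    unfolding C(3) by (rule left_mult_one_mat[OF RR])
  finally show thesis using that M S by simp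
qed

lemma single_layer_carrier [simp]:
  "single_layer vs es B \<Gamma> \<sigma> \<in> carrier_mat (length vs) (card (indices vs \<Gamma>))"
proof -
  obtain M where "M \<in> carrier_mat (card Io) (card (indices vs \<Gamma>))"
    "single_layer vs es B \<Gamma> \<sigma> = transpose_mat Ro * M"
    by (rule single_layer_eq)
  thus ?thesis by (auto intro!: mult_carrier_mat[of _ _ "card Io"])
qed

lemma single_layer_mult_vec_eq_0:
  assumes "\<phi> \<in> carrier_vec (card (indices vs \<Gamma>))" "i < length vs" "vs ! i \<in> B"
  shows "(cmat (single_layer vs es B \<Gamma> \<sigma>) *\<^sub>v \<phi>) $ i = 0"
proof -
  obtain M where M: "M \<in> carrier_mat (card Io) (card (indices vs \<Gamma>))"
    "single_layer vs es B \<Gamma> \<sigma> = transpose_mat Ro * M"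
    by (rule single_layer_eq)
  have RoT: "transpose_mat Ro \<in> carrier_mat (length vs) (card Io)" by simp
  have "cmat M *\<^sub>v \<phi> \<in> carrier_vec (card Io)"
    by (rule mult_mat_vec_carrier[OF _ assms(1)]) (use M in auto)
  thus ?thesis
    unfolding M(2) cmat_mult_mult_vec[OF RoT M(1) assms(1)]
    by (rule cmat_restr_transpose_mult_vec_eq_0) (use assms in auto)
qed

text \<open>Every index off \<open>B\<close> is picked by \<open>Io\<close>, so the matrix identity
  of \<open>single_layer_eq\<close> can be read entrywise: the potential has its density as
  source.\<close>

lemma laplacian_single_layer_mult_vec:
  assumes \<phi>: "\<phi> \<in> carrier_vec (card (indices vs \<Gamma>))" and i: "i < length vs" "vs ! i \<notin> B"
  shows "(cmat (laplacian vs es \<sigma>) *\<^sub>v (cmat (single_layer vs es B \<Gamma> \<sigma>) *\<^sub>v \<phi>)) $ i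
    = (cmat (transpose_mat (restr vs \<Gamma>)) *\<^sub>v \<phi>) $ i"
proof -
  let ?L = "laplacian vs es \<sigma>" and ?R = "transpose_mat (restr vs \<Gamma>)"
    and ?S = "single_layer vs es B \<Gamma> \<sigma>" and ?n = "length vs" and ?g = "card (indices vs \<Gamma>)"
  have eq: "Ro * (?L * ?S) = Ro * ?R" by (rule single_layer_eq)
  have LS: "?L * ?S \<in> carrier_mat ?n ?g"
    by (rule mult_carrier_mat[OF laplacian_carrier single_layer_carrier])
  have R: "?R \<in> carrier_mat ?n ?g" by simp
  obtain k where k: "k < card Io" "pick Io k = i"
    using i by (metis DiffI nth_mem pick_indices_surj)
  have pick: "(cmat A *\<^sub>v \<phi>) $ i = (cmat (Ro * A) *\<^sub>v \<phi>) $ k"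
    if A: "A \<in> carrier_mat ?n ?g" for A
  proof -
    have "cmat A *\<^sub>v \<phi> \<in> carrier_vec ?n"
      by (rule mult_mat_vec_carrier[OF _ \<phi>]) (use A in auto)
    thus ?thesis
      unfolding cmat_mult_mult_vec[OF restr_carrier A \<phi>] using k
      by (metis cmat_restr_mult_vec_index)
  qed
  show ?thesis
    unfolding cmat_mult_mult_vec[OF laplacian_carrier single_layer_carrier \<phi>, symmetric]
    by (simp only: pick[OF LS] pick[OF R] eq)
qed

text \<open>The minus sign in \<open>trace1_plus\<close> turns the sum of the two traces into a
  difference of one-sided Laplacians, evaluated at the vertex that restriction to \<Gamma>
  picks.\<close>

lemma neumann_poincare_mult_vec_index:
  fixes \<phi> :: "complex vec"
  assumes \<phi>: "\<phi> \<in> carrier_vec (card (indices vs \<Gamma>))" and k: "k < card (indices vs \<Gamma>)"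
  defines "u \<equiv> cmat (single_layer vs es B \<Gamma> \<sigma>) *\<^sub>v \<phi>"
  shows "(cmat (neumann_poincare vs es B \<Gamma> \<sigma> pp pm) *\<^sub>v \<phi>) $ k
    = ((cmat (laplacian vs es (cwise_mult pm \<sigma>)) *\<^sub>v u) $ pick (indices vs \<Gamma>) k
       - (cmat (laplacian vs es (cwise_mult pp \<sigma>)) *\<^sub>v u) $ pick (indices vs \<Gamma>) k) / 2"
proof -
  let ?R = "restr vs \<Gamma>" and ?S = "single_layer vs es B \<Gamma> \<sigma>" and ?n = "length vs"
    and ?g = "card (indices vs \<Gamma>)" and ?p = "pick (indices vs \<Gamma>) k"
  let ?Lp = "laplacian vs es (cwise_mult pp \<sigma>)" and ?Lm = "laplacian vs es (cwise_mult pm \<sigma>)"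
  have u: "u \<in> carrier_vec ?n" unfolding u_def
    by (rule mult_mat_vec_carrier[OF _ \<phi>]) simp
  have RL: "?R * laplacian vs es s \<in> carrier_mat ?g ?n" for s
    by (rule mult_carrier_mat[OF restr_carrier laplacian_carrier])
  define T where "T = - (?R * ?Lp) + ?R * ?Lm"
  have T: "T \<in> carrier_mat ?g ?n" using RL unfolding T_def by auto
  have TS: "T * ?S \<in> carrier_mat ?g ?g" by (rule mult_carrier_mat[OF T single_layer_carrier])
  have row: "(cmat (?R * laplacian vs es s) *\<^sub>v u) $ k = (cmat (laplacian vs es s) *\<^sub>v u) $ ?p" for s
    unfolding cmat_mult_mult_vec[OF restr_carrier laplacian_carrier u]
    by (rule cmat_restr_mult_vec_index[OF _ k], rule mult_mat_vec_carrier[OF _ u]) simp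
  have "neumann_poincare vs es B \<Gamma> \<sigma> pp pm = (1/2) \<cdot>\<^sub>m (T * ?S)"
    by (simp add: neumann_poincare_def trace1_plus_def trace1_minus_def T_def)
  moreover have "(cmat ((1/2) \<cdot>\<^sub>m A) *\<^sub>v \<phi>) $ k = (cmat A *\<^sub>v \<phi>) $ k / 2"
    if A: "A \<in> carrier_mat ?g ?g" for A
  proof -
    have "row (cmat ((1/2) \<cdot>\<^sub>m A)) k = (1/2) \<cdot>\<^sub>v row (cmat A) k"
      using A k by (intro eq_vecI) auto
    thus ?thesis using A \<phi> k by simp
  qed
  ultimately have "(cmat (neumann_poincare vs es B \<Gamma> \<sigma> pp pm) *\<^sub>v \<phi>) $ k
      = (cmat (T * ?S) *\<^sub>v \<phi>) $ k / 2"
    using TS by simp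
  also have "cmat (T * ?S) *\<^sub>v \<phi> = cmat T *\<^sub>v u"
    unfolding u_def by (rule cmat_mult_mult_vec[OF T single_layer_carrier \<phi>])
  also have "cmat T = cmat (?R * ?Lm) - cmat (?R * ?Lp)"
    using RL[of "cwise_mult pp \<sigma>"] RL[of "cwise_mult pm \<sigma>"] unfolding T_def
    by (intro eq_matI) auto
  also have "\<dots> *\<^sub>v u = cmat (?R * ?Lm) *\<^sub>v u - cmat (?R * ?Lp) *\<^sub>v u"
    using RL u by (intro minus_mult_distrib_mat_vec[of _ ?g ?n]) auto
  also have "\<dots> $ k = (cmat (?R * ?Lm) *\<^sub>v u) $ k - (cmat (?R * ?Lp) *\<^sub>v u) $ k"
    using k by simp
  finally show ?thesis unfolding row .
qed

end

section \<open>The spectral bound from comparing energies\<close>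

theorem theorem4p3:
  fixes \<G> :: "'v pair_pre_digraph"
    and vs :: "'v list" and es :: "('v \<times> 'v) list"
    and B \<Omega>p \<Gamma> \<Omega>m :: "'v set"
    and \<sigma> pp pm :: "real vec"
    and \<mu> :: complex
  assumes "pair_graph \<G>" and "connected (with_proj \<G>)"
    and "vertex_numbering \<G> vs" and "edge_numbering \<G> es"
    and "layered_partition \<G> B \<Omega>p \<Gamma> \<Omega>m"
    and "\<sigma> \<in> carrier_vec (length es)" and "\<forall>k < length es. \<sigma> $ k > 0"
    and "edge_partition_of_unity es B \<Omega>p \<Omega>m pp pm"
    and "eigenvalue (map_mat complex_of_real (neumann_poincare vs es B \<Gamma> \<sigma> pp pm)) \<mu>"
    and "\<mu> \<noteq> 1/2" and "\<mu> \<noteq> - 1/2"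
  shows "\<mu> \<in> complex_of_real ` {- 1/2 <..< 1/2}"
proof -
  let ?I = "indices vs \<Gamma>"
  let ?n = "length vs"
  let ?g = "card ?I"
  let ?S = "single_layer vs es B \<Gamma> \<sigma>"
  have part: "partition_on (pverts \<G>) {B, \<Omega>p, \<Gamma>, \<Omega>m}" and dist: "distinct [B, \<Omega>p, \<Gamma>, \<Omega>m]"
    using assms(5) unfolding layered_partition_def by auto
  have cover: "pverts \<G> = B \<union> \<Omega>p \<union> \<Gamma> \<union> \<Omega>m" and B0: "B \<noteq> {}"
    using partition_onD1[OF part] partition_onD3[OF part] by auto
  have disj: "B \<inter> \<Gamma> = {}" "\<Gamma> \<inter> \<Omega>p = {}" "\<Gamma> \<inter> \<Omega>m = {}"
    by (rule disjointD[OF partition_onD2[OF part]]; use dist in auto)+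
  interpret conductivity_network \<G> vs es B \<sigma>
    by (rule conductivity_network.intro) (use assms cover B0 in auto)
  let ?a = "cwise_mult pp \<sigma>" and ?b = "cwise_mult pm \<sigma>"
  let ?N = "neumann_poincare vs es B \<Gamma> \<sigma> pp pm"
  have ab: "?a $ k = pp $ k * \<sigma> $ k" "?b $ k = pm $ k * \<sigma> $ k" if "k < length es" for k
    using that assms(6) by (auto simp: cwise_mult_def)
  have pu: "pp $ k + pm $ k = 1" "0 \<le> pm $ k" "pm $ k \<le> 1" if "k < length es" for k
    using that assms(8) unfolding edge_partition_of_unity_def by auto
  have pp1: "pp $ k = 1" if "k \<in> edges_meeting es (B \<union> \<Omega>p)" for k
    using that assms(8) unfolding edge_partition_of_unity_def by auto
  have pm1: "pm $ k = 1" if "k \<in> edges_meeting es \<Omega>m" for k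
    using that assms(8) unfolding edge_partition_of_unity_def by auto
  have "dim_row ?N = ?g"
    by (simp add: neumann_poincare_def trace1_plus_def trace1_minus_def)
  then obtain \<phi> where \<phi>: "\<phi> \<in> carrier_vec ?g" "\<phi> \<noteq> 0\<^sub>v ?g" "cmat ?N *\<^sub>v \<phi> = \<mu> \<cdot>\<^sub>v \<phi>"
    using assms(9) unfolding eigenvalue_def eigenvector_def by auto
  define u where "u = cmat ?S *\<^sub>v \<phi>"
  have u: "u \<in> carrier_vec ?n" unfolding u_def
    by (rule mult_mat_vec_carrier[OF _ \<phi>(1)]) simp
  have uB: "u $ i = 0" if "i < ?n" "vs ! i \<in> B" for i
    unfolding u_def by (rule single_layer_mult_vec_eq_0[OF \<phi>(1) that])
  define lap where "lap s i = (cmat (laplacian vs es s) *\<^sub>v u) $ i" for s i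
  \<comment> \<open>\<Gamma> is disjoint from \<open>B\<close>, so the source identity applies
    there, and restriction after extension by zero returns \<phi>.\<close>
  have lap_interface: "lap \<sigma> (pick ?I k) = \<phi> $ k" if k: "k < ?g" for k
  proof -
    let ?Rt = "transpose_mat (restr vs \<Gamma>)"
    have "lap \<sigma> (pick ?I k) = (cmat ?Rt *\<^sub>v \<phi>) $ pick ?I k"
      unfolding lap_def u_def using pick_indices[OF k] disj
      by (intro laplacian_single_layer_mult_vec[OF \<phi>(1)]) auto
    also have "\<dots> = (cmat (restr vs \<Gamma>) *\<^sub>v (cmat ?Rt *\<^sub>v \<phi>)) $ k"
      by (rule cmat_restr_mult_vec_index[symmetric, OF _ k], rule mult_mat_vec_carrier[OF _ \<phi>(1)]) simp
    also have "\<dots> = (cmat (restr vs \<Gamma> * ?Rt) *\<^sub>v \<phi>) $ k"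
      by (subst cmat_mult_mult_vec[OF restr_carrier _ \<phi>(1)]) auto
    finally show ?thesis
      using \<phi>(1) by (simp add: restr_mult_restr_transpose of_real_hom.mat_hom_one)
  qed
  have lap_interior: "lap \<sigma> i = 0" if "i < ?n" "vs ! i \<notin> B" "vs ! i \<notin> \<Gamma>" for i
    using that laplacian_single_layer_mult_vec[OF \<phi>(1)] cmat_restr_transpose_mult_vec_eq_0[OF \<phi>(1)]
    unfolding lap_def u_def by simp
  have lap_split: "lap \<sigma> i = lap ?a i + lap ?b i" if "i < ?n" for i
  proof -
    have "\<sigma> $ k = ?a $ k + ?b $ k" if "k < length es" for k
      using pu(1)[OF that] ab[OF that] by (metis distrib_right mult_1)
    thus ?thesis unfolding lap_def laplacian_mult_vec_index[OF u that]
      by (simp add: sum.distrib[symmetric] ring_distribs del: index_mult_mat_vec)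
  qed
  \<comment> \<open>The eigenvalue equation lives on \<Gamma> only. It extends to all vertices off
    \<open>B\<close> because both sides vanish on \<open>\<Omega>p\<close> and
    \<open>\<Omega>m\<close>.\<close>
  have key: "lap ?b i = (\<mu> + 1/2) * lap \<sigma> i" if i: "i < ?n" "vs ! i \<notin> B" for i
  proof -
    have "vs ! i \<in> pverts \<G>"
      using i(1) assms(3) nth_mem unfolding vertex_numbering_def by blast
    then consider "vs ! i \<in> \<Gamma>" | "vs ! i \<in> \<Omega>p" | "vs ! i \<in> \<Omega>m" using cover i by blast
    thus ?thesis
    proof cases
      case 1
      then obtain k where k: "k < ?g" "pick ?I k = i" using i pick_indices_surj by metis
      have eig: "\<mu> * \<phi> $ k = (lap ?b i - lap ?a i) / 2"
        using neumann_poincare_mult_vec_index[OF \<phi>(1) k(1), of pp pm] \<phi> k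
        by (simp add: lap_def u_def del: index_mult_mat_vec)
      have \<phi>k: "lap \<sigma> i = \<phi> $ k" using lap_interface[OF k(1)] k(2) by simp
      \<comment> \<open>Half the difference of the two one-sided Laplacians plus half their sum
        leaves the minus part.\<close>
      have "(\<mu> + 1/2) * lap \<sigma> i = \<mu> * \<phi> $ k + lap \<sigma> i / 2"
        by (simp add: \<phi>k ring_distribs)
      thus ?thesis unfolding eig lap_split[OF i(1)] by (simp add: field_simps)
    next
      case 2
      \<comment> \<open>All edges at a vertex of \<open>\<Omega>p\<close> have \<open>pp\<close>
        equal to 1, so the plus part is the whole Laplacian and the minus part is zero.\<close>
      have "lap \<sigma> i = lap ?a i" unfolding lap_def
      proof (rule laplacian_mult_vec_cong[OF u i(1)])
        fix k assume "k \<in> edges_meeting es {vs ! i}"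
        hence "k < length es" "k \<in> edges_meeting es (B \<union> \<Omega>p)"
          using 2 by (auto simp: edges_meeting_def)
        thus "\<sigma> $ k = ?a $ k" by (simp add: ab pp1)
      qed
      thus ?thesis using lap_interior[OF i] lap_split[OF i(1)] 2 disj by auto
    next
      case 3
      \<comment> \<open>Here \<open>pm\<close> is 1 on all incident edges, so the minus part is the
        whole Laplacian, which vanishes off \<Gamma> and \<open>B\<close>.\<close>
      have "lap \<sigma> i = lap ?b i" unfolding lap_def
      proof (rule laplacian_mult_vec_cong[OF u i(1)])
        fix k assume "k \<in> edges_meeting es {vs ! i}"
        hence "k < length es" "k \<in> edges_meeting es \<Omega>m"
          using 3 by (auto simp: edges_meeting_def)
        thus "\<sigma> $ k = ?b $ k" by (simp add: ab pm1)
      qed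
      thus ?thesis using lap_interior[OF i] 3 disj by auto
    qed
  qed
  define energy where
    "energy s = (\<Sum>k<length es. s $ k * (cmod ((cmat (grad vs es) *\<^sub>v u) $ k))\<^sup>2)" for s :: "real vec"
  have energy_eq: "complex_of_real (energy s) = (\<Sum>i<?n. cnj (u $ i) * lap s i)" for s
    unfolding energy_def lap_def by (rule dirichlet_energy[OF u, symmetric])
  \<comment> \<open>The terms on \<open>B\<close> drop out because \<open>u\<close> vanishes there;
    all others are covered by \<open>key\<close>.\<close>
  have ratio: "complex_of_real (energy ?b) = (\<mu> + 1/2) * complex_of_real (energy \<sigma>)"
    unfolding energy_eq sum_distrib_left by (rule sum.cong) (use key uB in fastforce)+
  have nonneg: "0 \<le> energy ?b"
    unfolding energy_def by (rule sum_nonneg) (auto simp: ab pu pos less_imp_le)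
  have le: "energy ?b \<le> energy \<sigma>"
    unfolding energy_def
    by (intro sum_mono mult_right_mono) (auto simp: ab pu pos less_imp_le mult_left_le_one_le)
  \<comment> \<open>Zero energy would make \<open>u\<close> vanish, and with it the density \<phi>,
    which is the Laplacian of \<open>u\<close> on \<Gamma>.\<close>
  have nz: "energy \<sigma> \<noteq> 0"
  proof
    assume "energy \<sigma> = 0"
    hence "u = 0\<^sub>v ?n"
      unfolding energy_def by (intro eq_0_of_energy_eq_0[OF u] uB)
    hence "lap \<sigma> i = 0" if "i < ?n" for i
      using that by (simp add: lap_def scalar_prod_def)
    hence "\<phi> $ k = 0" if "k < ?g" for k
      using lap_interface[OF that] pick_indices(1)[OF that] by simp
    hence "\<phi> = 0\<^sub>v ?g"
      using \<phi>(1) by (intro eq_vecI) auto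
    thus False using \<phi>(2) by simp
  qed
  \<comment> \<open>Solving \<open>ratio\<close> for \<mu> gives a quotient of real energies, so
    \<mu> is real. The quotient lies in [0,1], and the shift by 1/2 centres this interval at
    zero.\<close>
  define r where "r = energy ?b / energy \<sigma> - 1/2"
  have \<mu>: "\<mu> = complex_of_real r"
    using ratio nz by (simp add: r_def field_simps)
  have "-1/2 \<le> r" "r \<le> 1/2"
    using nonneg le nz by (auto simp: r_def divide_simps)
  moreover have "r \<noteq> 1/2" "r \<noteq> -1/2"
  proof -
    show "r \<noteq> 1/2" using assms(10) unfolding \<mu> by (intro notI) simp
    show "r \<noteq> -1/2" using assms(11) unfolding \<mu> by (intro notI) simp
  qed
  ultimately show ?thesis unfolding \<mu> by auto
qed

end
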